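(* Let $X$ be a real Banach space and let $C\subset X$ be a closed reproducing cone containing no nontrivial affine subspaces of $X$. Order $X$ by $x\ge y\iff x-y\in C$, and suppose $C_N\neq\emptyset$. Let $u,v\in C_N$, let $X_u=C_u\cap(-C_u)$ and $X_v=C_v\cap(-C_v)$, and let $$\|x\|_u=\inf\{\lambda>0:x\in\lambda[-u,u]\}\ (x\in X_u),\qquad \|x\|_v=\inf\{\lambda>0:x\in\lambda[-v,v]\}\ (x\in X_v).$$ Then the following statements are equivalent: (i) $X_u=X_v$ algebraically (as sets); (ii) $u\sim v$, i.e. there is a constant $c\ge1$ such that $c^{-1}u\le v\le cu$; (iii) $\|\cdot\|_u\sim\|\cdot\|_v$, i.e. there is a constant $c\ge1$ such that $c^{-1}\|\cdot\|_u\le\|\cdot\|_v\le c\|\cdot\|_u$.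
   Context: A cone (with vertex at the origin) is a convex set closed under addition and under multiplication by nonnegative scalars; it is reproducing if $C-C=X$. A point $x\in C$ is a support point of $C$ if there is a nonzero $x^*\in X^*$ with $\langle x^*,x\rangle=\max\{\langle x^*,y\rangle:y\in C\}$; $C_N$ is the set of non-support points of $C$. For $w\in C$, $C_w=\bigcup_{\lambda>0}\lambda(C-w)$ and $[-w,w]=\{x\in X:-w\le x\le w\}$. The norms $\|\cdot\|_u,\|\cdot\|_v$ are regarded as extended-real-valued functions on $X$, equal to $+\infty$ outside $X_u$, respectively $X_v$; the inequalities in (iii) are between these functions on $X$. *)

theory Defs
  imports "HOL-Analysis.Analysis"
begin

text \<open>
  The order \<open>x \<le> y\<close> induced by a cone \<open>C\<close> is written \<open>cone_le C x y\<close>,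
  with the cone as a parameter; on sets, \<open>-\<close> is set difference, so algebraic differences
  are written out elementwise.
\<close>

definition reproducing :: "'a::real_vector set \<Rightarrow> bool" where
  "reproducing C \<longleftrightarrow> {x - y | x y. x \<in> C \<and> y \<in> C} = UNIV"

definition no_nontrivial_affine_subspace :: "'a::real_vector set \<Rightarrow> bool" where
  "no_nontrivial_affine_subspace C \<longleftrightarrow> (\<forall>A. affine A \<and> A \<subseteq> C \<longrightarrow> (\<exists>a. A \<subseteq> {a}))"

definition cone_le :: "'a::real_vector set \<Rightarrow> 'a \<Rightarrow> 'a \<Rightarrow> bool" where
  "cone_le C x y \<longleftrightarrow> y - x \<in> C"

definition support_point :: "'a::real_normed_vector set \<Rightarrow> 'a \<Rightarrow> bool" where
  "support_point C x \<longleftrightarrow>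
     x \<in> C \<and> (\<exists>f :: 'a \<Rightarrow>\<^sub>L real. f \<noteq> 0 \<and> (\<forall>y\<in>C. blinfun_apply f y \<le> blinfun_apply f x))"

definition nonsupport_points :: "'a::real_normed_vector set \<Rightarrow> 'a set" where
  "nonsupport_points C = {x \<in> C. \<not> support_point C x}"

definition cone_at :: "'a::real_vector set \<Rightarrow> 'a \<Rightarrow> 'a set" where
  "cone_at C w = (\<Union>l\<in>{l::real. l > 0}. (\<lambda>y. l *\<^sub>R (y - w)) ` C)"

definition order_interval :: "'a::real_vector set \<Rightarrow> 'a \<Rightarrow> 'a set" where
  "order_interval C w = {x. cone_le C (- w) x \<and> cone_le C x w}"

definition unit_space :: "'a::real_vector set \<Rightarrow> 'a \<Rightarrow> 'a set" where
  "unit_space C w = cone_at C w \<inter> uminus ` cone_at C w"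

text \<open>
  The infimum is taken in \<^typ>\<open>ereal\<close>. For \<open>w \<in> C\<close> with \<open>C\<close> a convex cone and \<open>x \<in> unit_space C w\<close>
  the index set is nonempty and bounded below by 0, so the value is the usual real infimum.
\<close>

definition unit_norm :: "'a::real_vector set \<Rightarrow> 'a \<Rightarrow> 'a \<Rightarrow> ereal" where
  "unit_norm C w x =
     (if x \<in> unit_space C w
      then INF l\<in>{l::real. l > 0 \<and> x \<in> (*\<^sub>R) l ` order_interval C w}. ereal l
      else \<infinity>)"

end

theory Submission
  imports Defs
begin

text \<open>
  Everything is read off the set of scales \<open>l > 0\<close> with \<open>-l w \<le> x \<le> l w\<close>: it is nonempty iff
  \<open>x \<in> X\<^sub>w\<close>, and its infimum, with the convention that the infimum of the empty set is
  \<open>\<infinity>\<close>, is \<open>\<parallel>x\<parallel>\<^sub>w\<close>. If \<open>u \<le> c v\<close>, multiplication by \<open>c\<close> maps the scales of \<open>x\<close>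
  for \<open>u\<close> to scales for \<open>v\<close>, which gives \<open>X\<^sub>u \<subseteq> X\<^sub>v\<close> and \<open>\<parallel>\<cdot>\<parallel>\<^sub>v \<le> c \<parallel>\<cdot>\<parallel>\<^sub>u\<close>. Conversely \<open>u\<close> itself
  belongs to \<open>X\<^sub>u\<close> and has \<open>\<parallel>u\<parallel>\<^sub>u \<le> 1\<close>, so either the inclusion or the norm inequality puts
  \<open>u\<close> into \<open>X\<^sub>v\<close>, which means \<open>u \<le> c v\<close> for some \<open>c\<close>.
\<close>

definition scales :: "'a::real_vector set \<Rightarrow> 'a \<Rightarrow> 'a \<Rightarrow> real set" where
  "scales C w x = {l. l > 0 \<and> l *\<^sub>R w + x \<in> C \<and> l *\<^sub>R w - x \<in> C}"

text \<open>The difference \<open>(b - a) *\<^sub>R w\<close> lies in the cone. Hence scales can be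
  enlarged freely, and two constants can be replaced by their maximum.\<close>

lemma convex_cone_scaleR_mono:
  fixes a b :: real
  assumes "convex_cone C" "w \<in> C" "a *\<^sub>R w + x \<in> C" "a \<le> b"
  shows "b *\<^sub>R w + x \<in> C"
proof -
  have "(b - a) *\<^sub>R w \<in> C"
    using assms by (simp add: convex_cone_scaleR)
  then have "(b - a) *\<^sub>R w + (a *\<^sub>R w + x) \<in> C"
    using assms(1,3) by (simp add: convex_cone_add)
  then show ?thesis
    by (simp add: algebra_simps)
qed

text \<open>The equation \<open>x = l *\<^sub>R (y - w)\<close> rearranges to
  \<open>l *\<^sub>R w + x = l *\<^sub>R y\<close>, and positive scaling maps \<open>C\<close> onto
  itself.\<close>

lemma mem_cone_at_iff: "x \<in> cone_at C w \<longleftrightarrow> (\<exists>l>0. l *\<^sub>R w + x \<in> C)"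
  if "convex_cone C"
proof
  assume "x \<in> cone_at C w"
  then obtain l y where "l > 0" "y \<in> C" "x = l *\<^sub>R (y - w)"
    by (auto simp: cone_at_def)
  then have "l *\<^sub>R w + x = l *\<^sub>R y"
    by (simp add: algebra_simps)
  then have "l *\<^sub>R w + x \<in> C"
    using convex_cone_scaleR[OF that, of l y] \<open>l > 0\<close> \<open>y \<in> C\<close> by simp
  with \<open>l > 0\<close> show "\<exists>l>0. l *\<^sub>R w + x \<in> C"
    by blast
next
  assume "\<exists>l>0. l *\<^sub>R w + x \<in> C"
  then obtain l :: real where l: "l > 0" "l *\<^sub>R w + x \<in> C"
    by blast
  then have "inverse l *\<^sub>R (l *\<^sub>R w + x) \<in> C"
    using convex_cone_scaleR[OF that] by simp
  moreover have "x = l *\<^sub>R (inverse l *\<^sub>R (l *\<^sub>R w + x) - w)"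
    using l by (simp add: algebra_simps)
  ultimately show "x \<in> cone_at C w"
    unfolding cone_at_def using l(1) by blast
qed

lemma mem_unit_space_iff: "x \<in> unit_space C w \<longleftrightarrow> scales C w x \<noteq> {}"
  if C: "convex_cone C" and w: "w \<in> C"
proof -
  have "x \<in> unit_space C w \<longleftrightarrow> x \<in> cone_at C w \<and> - x \<in> cone_at C w"
    unfolding unit_space_def by force
  also have "\<dots> \<longleftrightarrow> (\<exists>l>0. l *\<^sub>R w + x \<in> C) \<and> (\<exists>l>0. l *\<^sub>R w + - x \<in> C)"
    by (simp only: mem_cone_at_iff[OF C])
  also have "\<dots> \<longleftrightarrow> scales C w x \<noteq> {}"
  proof
    assume "(\<exists>l>0. l *\<^sub>R w + x \<in> C) \<and> (\<exists>l>0. l *\<^sub>R w + - x \<in> C)"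
    then obtain k l :: real
      where "k > 0" "k *\<^sub>R w + x \<in> C" "l > 0" "l *\<^sub>R w + - x \<in> C"
      by blast
    \<comment> \<open>The two one-sided conditions come with different scales; their maximum serves
      both.\<close>
    then have "max k l > 0" "max k l *\<^sub>R w + x \<in> C" "max k l *\<^sub>R w + - x \<in> C"
      using convex_cone_scaleR_mono[OF C w, of k x] convex_cone_scaleR_mono[OF C w, of l "- x"]
      by auto
    then show "scales C w x \<noteq> {}"
      unfolding scales_def by auto
  qed (auto simp: scales_def)
  finally show ?thesis .
qed

lemma mem_scaleR_order_interval_iff:
  "x \<in> (*\<^sub>R) l ` order_interval C w \<longleftrightarrow> l *\<^sub>R w + x \<in> C \<and> l *\<^sub>R w - x \<in> C"
  if C: "convex_cone C" and l: "l > 0"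
proof
  assume "x \<in> (*\<^sub>R) l ` order_interval C w"
  then obtain y where y: "x = l *\<^sub>R y" "y + w \<in> C" "w - y \<in> C"
    by (auto simp: order_interval_def cone_le_def)
  then have "l *\<^sub>R (y + w) \<in> C" "l *\<^sub>R (w - y) \<in> C"
    using convex_cone_scaleR[OF C] l by auto
  then show "l *\<^sub>R w + x \<in> C \<and> l *\<^sub>R w - x \<in> C"
    by (simp add: y(1) algebra_simps)
next
  assume "l *\<^sub>R w + x \<in> C \<and> l *\<^sub>R w - x \<in> C"
  then have "inverse l *\<^sub>R (l *\<^sub>R w + x) \<in> C" "inverse l *\<^sub>R (l *\<^sub>R w - x) \<in> C"
    using convex_cone_scaleR[OF C] l by auto
  then have "inverse l *\<^sub>R x \<in> order_interval C w"
    using l by (simp add: order_interval_def cone_le_def algebra_simps)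
  moreover have "x = l *\<^sub>R (inverse l *\<^sub>R x)"
    using l by simp
  ultimately show "x \<in> (*\<^sub>R) l ` order_interval C w"
    by blast
qed

text \<open>The case distinction in \<open>unit_norm\<close> disappears: outside
  \<open>unit_space C w\<close> there are no scales, and the infimum of the empty set in
  \<open>ereal\<close> is \<infinity>.\<close>

lemma unit_norm_eq_INF: "unit_norm C w x = (INF l\<in>scales C w x. ereal l)"
  if C: "convex_cone C" and w: "w \<in> C"
proof -
  have "{l. l > 0 \<and> x \<in> (*\<^sub>R) l ` order_interval C w} = scales C w x"
    using mem_scaleR_order_interval_iff[OF C] unfolding scales_def by blast
  then show ?thesis
    by (simp add: unit_norm_def mem_unit_space_iff[OF C w] top_ereal_def)
qed

text \<open>Every scale is a finite real, so the infimum is below \<infinity> as soon as one scale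
  exists.\<close>

lemma unit_norm_less_PInf_iff: "unit_norm C w x < \<infinity> \<longleftrightarrow> x \<in> unit_space C w"
  if C: "convex_cone C" and w: "w \<in> C"
  unfolding unit_norm_eq_INF[OF that] mem_unit_space_iff[OF that] INF_less_iff by auto

lemma self_mem_unit_space: "w \<in> unit_space C w"
  if C: "convex_cone C" and w: "w \<in> C"
proof -
  have "1 \<in> scales C w w"
    using convex_cone_add[OF C w w] convex_cone_contains_0[OF C] by (simp add: scales_def)
  then show ?thesis
    using mem_unit_space_iff[OF that] by blast
qed

lemma scales_mult:
  assumes C: "convex_cone C" and c: "c > 0" "cone_le C u (c *\<^sub>R v)" and l: "l \<in> scales C u x"
  shows "l * c \<in> scales C v x"
proof -
  \<comment> \<open>The sum of \<open>l *\<^sub>R (c *\<^sub>R v - u)\<close> and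
    \<open>l *\<^sub>R u + y\<close> is \<open>(l * c) *\<^sub>R v + y\<close>. Keeping
    \<open>y\<close> arbitrary covers both \<open>x\<close> and \<open>- x\<close>.\<close>
  have *: "(l * c) *\<^sub>R v + y \<in> C" if "l *\<^sub>R u + y \<in> C" for y
  proof -
    have "l *\<^sub>R (c *\<^sub>R v - u) \<in> C"
      using convex_cone_scaleR[OF C] c l by (simp add: cone_le_def scales_def)
    from convex_cone_add[OF C this that] show ?thesis
      by (simp add: algebra_simps)
  qed
  from *[of x] *[of "- x"] c l show ?thesis
    by (simp add: scales_def)
qed

lemma unit_space_mono:
  assumes "convex_cone C" "u \<in> C" "v \<in> C" "c > 0" "cone_le C u (c *\<^sub>R v)"
  shows "unit_space C u \<subseteq> unit_space C v"
  using scales_mult[OF assms(1,4,5)] mem_unit_space_iff assms(1-3) by blast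

lemma unit_norm_le:
  assumes C: "convex_cone C" and u: "u \<in> C" and v: "v \<in> C"
    and c: "c > 0" "cone_le C u (c *\<^sub>R v)"
  shows "ereal (inverse c) * unit_norm C v x \<le> unit_norm C u x"
  unfolding unit_norm_eq_INF[OF C u]
proof (rule INF_greatest)
  fix l assume "l \<in> scales C u x"
  then have "unit_norm C v x \<le> ereal (l * c)"
    unfolding unit_norm_eq_INF[OF C v] by (intro INF_lower scales_mult[OF C c])
  then have "ereal (inverse c) * unit_norm C v x \<le> ereal (inverse c) * ereal (l * c)"
    using c by (intro ereal_mult_left_mono) auto
  then show "ereal (inverse c) * unit_norm C v x \<le> ereal l"
    using c by (simp add: field_simps)
qed

lemma mem_unit_spaceE:
  assumes "convex_cone C" "u \<in> unit_space C v" "v \<in> C"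
  obtains c where "c \<ge> 1" "cone_le C u (c *\<^sub>R v)"
proof -
  obtain l where l: "l *\<^sub>R v + - u \<in> C"
    using assms mem_unit_space_iff by (fastforce simp: scales_def)
  have "max 1 l *\<^sub>R v + - u \<in> C"
    using convex_cone_scaleR_mono[OF assms(1,3) l] by simp
  then show ?thesis
    using that[of "max 1 l"] by (simp add: cone_le_def)
qed

text \<open>Scaling by \<open>c\<close> or its inverse preserves the order. This gives both halves
  of the order equivalence the same shape, symmetric in \<open>u\<close> and
  \<open>v\<close>.\<close>

lemma cone_le_inverse_iff:
  "cone_le C (inverse c *\<^sub>R u) v \<longleftrightarrow> cone_le C u (c *\<^sub>R v)"
  if C: "convex_cone C" and c: "c > 0"
proof
  assume "cone_le C (inverse c *\<^sub>R u) v"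
  then have "c *\<^sub>R (v - inverse c *\<^sub>R u) \<in> C"
    using convex_cone_scaleR[OF C] c by (simp add: cone_le_def)
  then show "cone_le C u (c *\<^sub>R v)"
    using c by (simp add: cone_le_def algebra_simps)
next
  assume "cone_le C u (c *\<^sub>R v)"
  then have "inverse c *\<^sub>R (c *\<^sub>R v - u) \<in> C"
    using convex_cone_scaleR[OF C] c by (simp add: cone_le_def)
  then show "cone_le C (inverse c *\<^sub>R u) v"
    using c by (simp add: cone_le_def algebra_simps)
qed

lemma ereal_inverse_mult_le_iff:
  "ereal (inverse c) * a \<le> b \<longleftrightarrow> a \<le> ereal c * b" if "c > 0"
  using that by (cases a; cases b) (auto simp: field_simps)

lemma order_equivalent_iff_mutual_mem:
  assumes C: "convex_cone C" and u: "u \<in> C" and v: "v \<in> C"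
  shows "(\<exists>c::real. c \<ge> 1 \<and> cone_le C (inverse c *\<^sub>R u) v \<and> cone_le C v (c *\<^sub>R u)) \<longleftrightarrow>
    u \<in> unit_space C v \<and> v \<in> unit_space C u" (is "?L \<longleftrightarrow> ?R")
proof
  assume ?L
  then obtain c :: real
    where "c \<ge> 1" "cone_le C (inverse c *\<^sub>R u) v" "cone_le C v (c *\<^sub>R u)"
    by blast
  then have c: "c > 0" "cone_le C u (c *\<^sub>R v)" "cone_le C v (c *\<^sub>R u)"
    using cone_le_inverse_iff[OF C, of c u v] by auto
  show ?R
    using unit_space_mono[OF C u v c(1,2)] unit_space_mono[OF C v u c(1,3)]
      self_mem_unit_space[OF C u] self_mem_unit_space[OF C v] by blast
next
  assume ?R
  then obtain k l where k: "k \<ge> 1" "cone_le C u (k *\<^sub>R v)" and l: "l \<ge> 1" "cone_le C v (l *\<^sub>R u)"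
    using mem_unit_spaceE[OF C] u v by metis
  \<comment> \<open>The equivalence asks for a single constant in both directions.\<close>
  have "max k l *\<^sub>R v + - u \<in> C" "max k l *\<^sub>R u + - v \<in> C"
    using k l convex_cone_scaleR_mono[OF C v, of k "- u"] convex_cone_scaleR_mono[OF C u, of l "- v"]
    by (auto simp: cone_le_def)
  then show ?L
    using k(1) cone_le_inverse_iff[OF C, of "max k l"]
    by (intro exI[of _ "max k l"]) (auto simp: cone_le_def)
qed

theorem theorem6:
  fixes C :: "'a::banach set" and u v :: 'a
  assumes "convex_cone C"
    and "closed C"
    and "reproducing C"
    and "no_nontrivial_affine_subspace C"
    and "nonsupport_points C \<noteq> {}"
    and "u \<in> nonsupport_points C"
    and "v \<in> nonsupport_points C"
  shows "(unit_space C u = unit_space C v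
            \<longleftrightarrow> (\<exists>c::real. c \<ge> 1 \<and> cone_le C (inverse c *\<^sub>R u) v \<and> cone_le C v (c *\<^sub>R u)))
       \<and> ((\<exists>c::real. c \<ge> 1 \<and> cone_le C (inverse c *\<^sub>R u) v \<and> cone_le C v (c *\<^sub>R u))
            \<longleftrightarrow> (\<exists>c::real. c \<ge> 1 \<and>
                  (\<forall>x. ereal (inverse c) * unit_norm C u x \<le> unit_norm C v x
                     \<and> unit_norm C v x \<le> ereal c * unit_norm C u x)))"
proof -
  have C: "convex_cone C" and u: "u \<in> C" and v: "v \<in> C"
    using assms by (auto simp: nonsupport_points_def)
  define ord where
    "ord \<longleftrightarrow> (\<exists>c::real. c \<ge> 1 \<and> cone_le C (inverse c *\<^sub>R u) v \<and> cone_le C v (c *\<^sub>R u))"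
  define nrm where "nrm \<longleftrightarrow> (\<exists>c::real. c \<ge> 1 \<and>
    (\<forall>x. ereal (inverse c) * unit_norm C u x \<le> unit_norm C v x
       \<and> unit_norm C v x \<le> ereal c * unit_norm C u x))"
  note ord_iff = order_equivalent_iff_mutual_mem[OF C u v, folded ord_def]
  have "unit_space C u = unit_space C v" and nrm if ord
  proof -
    from that obtain c :: real
      where "c \<ge> 1" "cone_le C (inverse c *\<^sub>R u) v" "cone_le C v (c *\<^sub>R u)"
      unfolding ord_def by blast
    then have c: "c \<ge> 1" "cone_le C u (c *\<^sub>R v)" "cone_le C v (c *\<^sub>R u)" and "c > 0"
      using cone_le_inverse_iff[OF C, of c u v] by auto
    show "unit_space C u = unit_space C v"
      using unit_space_mono[OF C u v \<open>c > 0\<close> c(2)] unit_space_mono[OF C v u \<open>c > 0\<close> c(3)] by blast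
    show nrm
      \<comment> \<open>One instance of \<open>unit_norm_le\<close> is the lower bound as it stands;
        the other becomes the upper bound after multiplication by \<open>c\<close>.\<close>
      unfolding nrm_def
      using unit_norm_le[OF C u v \<open>c > 0\<close> c(2)] unit_norm_le[OF C v u \<open>c > 0\<close> c(3)]
        ereal_inverse_mult_le_iff[OF \<open>c > 0\<close>] c(1) by blast
  qed
  moreover have ord if "unit_space C u = unit_space C v"
    using that ord_iff self_mem_unit_space[OF C u] self_mem_unit_space[OF C v] by blast
  moreover have ord if nrm
  proof -
    from that obtain c :: real where c: "c \<ge> 1" and
      *: "\<And>x. ereal (inverse c) * unit_norm C u x \<le> unit_norm C v x
        \<and> unit_norm C v x \<le> ereal c * unit_norm C u x"
      unfolding nrm_def by blast
    have le: "unit_norm C u x \<le> ereal c * unit_norm C v x"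
      "unit_norm C v x \<le> ereal c * unit_norm C u x" for x
      using *[of x] c ereal_inverse_mult_le_iff[of c] by simp_all
    have fin: "ereal c * a < \<infinity>" if "a < \<infinity>" for a
      using that c by (cases a) auto
    \<comment> \<open>Each of \<open>u\<close> and \<open>v\<close> has finite norm in its own
      space, and the inequalities in \<open>le\<close> carry finiteness over to the other norm,
      which is membership in the other space.\<close>
    have "unit_norm C u u < \<infinity>" "unit_norm C v v < \<infinity>"
      using unit_norm_less_PInf_iff[OF C] self_mem_unit_space[OF C] u v by blast+
    then have "unit_norm C u v < \<infinity>" "unit_norm C v u < \<infinity>"
      using le[THEN le_less_trans, OF fin] by blast+
    then show ord
      using ord_iff unit_norm_less_PInf_iff[OF C u] unit_norm_less_PInf_iff[OF C v] by blast
  qed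
  ultimately have "(unit_space C u = unit_space C v \<longleftrightarrow> ord) \<and> (ord \<longleftrightarrow> nrm)"
    by blast
  then show ?thesis
    unfolding ord_def nrm_def .
qed

end
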